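(* Let $G$ and $H$ be groups with symmetric generating sets $X$ and $Y$ respectively, $\Lambda$ and $\Gamma$ finite alphabets, and let $\mathcal C$ be a class of formal languages that is closed under intersection with regular languages, finite intersection and inverse homomorphism. If $(G,X,\Lambda)$ and $(H,Y,\Gamma)$ are $\mathcal C$-graph automatic, then the group $G\times H$ is $\mathcal C$-graph automatic.
   Context: A generating set is symmetric if it is closed under inverses; it need not be finite. A normal form for $(G,X,\Lambda)$ is a set $L\subseteq\Lambda^*$ in bijection with $G$; the image of $u\in L$ is denoted $\overline u$. Convolution: let $\diamond\notin\Lambda$ and $\Lambda_\diamond=\Lambda\cup\{\diamond\}$. For $u,v\in\Lambda^*$, $\otimes(u,v)$ is the word of length $\max(|u|,|v|)$ over $(\Lambda_\diamond)^2$ whose $i$th letter has first component the $i$th letter of $u$ if $i\le|u|$ and $\diamond$ otherwise, and second component the $i$th letter of $v$ if $i\le|v|$ and $\diamond$ otherwise. $(G,X,\Lambda)$ is $\mathcal C$-graph automatic if there is a normal form $L\subseteq\Lambda^*$ in $\mathcal C$ such that for each $x\in X$ the language $L_x=\{\otimes(u,v)\mid u,v\in L,\ \overline v=_G\overline u x\}$ is in $\mathcal C$. A group is called $\mathcal C$-graph automatic if it is so for some symmetric generating set and some finite alphabet. $\mathcal C$ is closed under inverse homomorphism if for all finite alphabets $\Delta,\Sigma$, every monoid homomorphism $\phi:\Delta^*\to\Sigma^*$, and every $M\subseteq\Sigma^*$ in $\mathcal C$, the language $\phi^{-1}(M)$ is in $\mathcal C$. *)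

theory Defs
  imports "HOL-Algebra.Generated_Groups"
begin

text \<open>
  A class of languages ranges over languages on many different finite alphabets, including the
  alphabets of convolutions of words, of convolutions of convolutions, and so on. All alphabets are
  therefore finite subsets of one universe of letters that is closed under \<open>\<Sigma> \<mapsto> (\<Sigma>\<^sub>\<diamond>)\<^sup>2\<close>.
  The constructor \<open>Pr\<close> forms the letters of \<open>(\<Sigma>\<^sub>\<diamond>)\<^sup>2\<close>, where the padding
  symbol \<open>\<diamond>\<close> is \<open>None\<close>, and so is automatically not a member of \<open>\<Sigma>\<close>.
\<close>

datatype 'a letter = Atom 'a | Pr "'a letter option" "'a letter option"

type_synonym 'a language = "'a letter list set"

definition conv :: "'a letter list \<Rightarrow> 'a letter list \<Rightarrow> 'a letter list" where
  "conv u v =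
     map (\<lambda>i. Pr (if i < length u then Some (u ! i) else None)
                 (if i < length v then Some (v ! i) else None))
       [0..<max (length u) (length v)]"


definition language_class :: "'a language set \<Rightarrow> bool" where
  "language_class C \<longleftrightarrow> (\<forall>L\<in>C. \<exists>\<Sigma>. finite \<Sigma> \<and> L \<subseteq> lists \<Sigma>)"

text \<open>
  Acceptance by a deterministic finite automaton. States can be taken to be natural
  numbers, since the state set is finite.
\<close>

definition regular_language :: "'a language \<Rightarrow> bool" where
  "regular_language R \<longleftrightarrow>
     (\<exists>\<Sigma> (Q :: nat set) q0 \<delta> F.
        finite \<Sigma> \<and> finite Q \<and> q0 \<in> Q \<and> F \<subseteq> Q \<and>
        (\<forall>q\<in>Q. \<forall>a\<in>\<Sigma>. \<delta> q a \<in> Q) \<and>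
        R = {w \<in> lists \<Sigma>. foldl \<delta> q0 w \<in> F})"

definition closed_inter_regular :: "'a language set \<Rightarrow> bool" where
  "closed_inter_regular C \<longleftrightarrow> (\<forall>L\<in>C. \<forall>R. regular_language R \<longrightarrow> L \<inter> R \<in> C)"

text \<open>The empty intersection would be the set of all words over the infinite universe of letters,
  which is not a language over a finite alphabet.\<close>

definition closed_finite_inter :: "'a language set \<Rightarrow> bool" where
  "closed_finite_inter C \<longleftrightarrow> (\<forall>\<F>. \<F> \<subseteq> C \<and> finite \<F> \<and> \<F> \<noteq> {} \<longrightarrow> \<Inter>\<F> \<in> C)"

definition word_hom ::
  "'a letter set \<Rightarrow> 'a letter set \<Rightarrow> ('a letter list \<Rightarrow> 'a letter list) \<Rightarrow> bool" where
  "word_hom \<Delta> \<Sigma> \<phi> \<longleftrightarrow>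
     (\<forall>u\<in>lists \<Delta>. \<phi> u \<in> lists \<Sigma>) \<and> \<phi> [] = [] \<and>
     (\<forall>u\<in>lists \<Delta>. \<forall>v\<in>lists \<Delta>. \<phi> (u @ v) = \<phi> u @ \<phi> v)"

definition closed_inverse_hom :: "'a language set \<Rightarrow> bool" where
  "closed_inverse_hom C \<longleftrightarrow>
     (\<forall>\<Delta> \<Sigma> \<phi> M. finite \<Delta> \<and> finite \<Sigma> \<and> word_hom \<Delta> \<Sigma> \<phi> \<and> M \<subseteq> lists \<Sigma> \<and> M \<in> C \<longrightarrow>
        {w \<in> lists \<Delta>. \<phi> w \<in> M} \<in> C)"


definition symmetric_generating_set :: "('g, 'm) monoid_scheme \<Rightarrow> 'g set \<Rightarrow> bool" where
  "symmetric_generating_set G X \<longleftrightarrow>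
     X \<subseteq> carrier G \<and> generate G X = carrier G \<and> (\<forall>x\<in>X. inv\<^bsub>G\<^esub> x \<in> X)"

text \<open>A normal form comes with a chosen bijection \<open>bar\<close> onto the group; this is an arbitrary
  bijection, since words over \<open>\<Lambda>\<close> need not be words in the generators.\<close>

definition normal_form ::
  "('g, 'm) monoid_scheme \<Rightarrow> 'a letter set \<Rightarrow> 'a language \<Rightarrow> ('a letter list \<Rightarrow> 'g) \<Rightarrow> bool" where
  "normal_form G \<Lambda> L bar \<longleftrightarrow> L \<subseteq> lists \<Lambda> \<and> bij_betw bar L (carrier G)"

definition mult_language ::
  "('g, 'm) monoid_scheme \<Rightarrow> 'a language \<Rightarrow> ('a letter list \<Rightarrow> 'g) \<Rightarrow> 'g \<Rightarrow> 'a language" where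
  "mult_language G L bar x = {conv u v | u v. u \<in> L \<and> v \<in> L \<and> bar v = bar u \<otimes>\<^bsub>G\<^esub> x}"

definition graph_automatic ::
  "'a language set \<Rightarrow> ('g, 'm) monoid_scheme \<Rightarrow> 'g set \<Rightarrow> 'a letter set \<Rightarrow> bool" where
  "graph_automatic C G X \<Lambda> \<longleftrightarrow>
     (\<exists>L bar. normal_form G \<Lambda> L bar \<and> L \<in> C \<and> (\<forall>x\<in>X. mult_language G L bar x \<in> C))"

definition graph_automatic_group :: "'a language set \<Rightarrow> ('g, 'm) monoid_scheme \<Rightarrow> bool" where
  "graph_automatic_group C G \<longleftrightarrow>
     (\<exists>X \<Lambda>. symmetric_generating_set G X \<and> finite \<Lambda> \<and> graph_automatic C G X \<Lambda>)"

end

theory Submission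
  imports Defs
begin

text \<open>
  Write \<open>L\<^sub>G\<close> and \<open>L\<^sub>H\<close> for the given normal forms. An element \<open>(g, h)\<close> of the product is represented
  by the convolution of the representatives of \<open>g\<close> and \<open>h\<close>, and the generators are the pairs
  \<open>(x, 1)\<close> and \<open>(1, y)\<close>.

  A letter of a convolution has two components, and a letter of a convolution of convolutions has
  four. Following one component through a word, and skipping the padding symbols, is an erasing
  letter-to-letter homomorphism, namely \<open>List.map_filter\<close> applied to a partial map on letters.
  Inverse homomorphisms therefore express that the word on one track lies in \<open>L\<^sub>G\<close>, or that the
  convolution of the words on two tracks lies in \<open>L\<^sub>x\<close>. What the homomorphism forgets is where the
  padding was. That padding occurs only at the end of a track is a regular condition,
  recognised by a three-state automaton, and this is the only use of regular languages
  (\<open>convolutions_in_class\<close>).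

  Right multiplication by \<open>(x, 1)\<close> takes \<open>\<otimes>(u, v)\<close> to \<open>\<otimes>(u', v)\<close> with \<open>\<otimes>(u, u')\<close> in \<open>L\<^sub>x\<close>. Given a
  convolution of two normal forms, the first condition is an inverse homomorphism, and that the
  second tracks agree can be checked letter by letter, so it is a restriction of the alphabet
  (\<open>track_multiplication_in_class\<close>). The generators \<open>(1, y)\<close> are treated by exchanging the tracks.
\<close>

section \<open>Tracks and convolutions\<close>

definition letter_at :: "'b list \<Rightarrow> nat \<Rightarrow> 'b option" where
  "letter_at u i = (if i < length u then Some (u ! i) else None)"

text \<open>
  A track is a partial map \<open>r\<close> on letters, undefined where the track carries padding. On a padded
  word, the defined letters form a prefix, so that \<open>List.map_filter r\<close> preserves positions.
\<close>

definition padded :: "('b \<Rightarrow> 'c option) \<Rightarrow> 'b list \<Rightarrow> bool" where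
  "padded r = sorted_wrt (\<lambda>a b. r a = None \<longrightarrow> r b = None)"

fun fst_track :: "'a letter \<Rightarrow> 'a letter option" where
  "fst_track (Pr a b) = a"
| "fst_track (Atom a) = None"

fun snd_track :: "'a letter \<Rightarrow> 'a letter option" where
  "snd_track (Pr a b) = b"
| "snd_track (Atom a) = None"

lemma letter_at_simps [simp]:
  "letter_at [] i = None"
  "letter_at (a # u) 0 = Some a"
  "letter_at (a # u) (Suc i) = letter_at u i"
  by (simp_all add: letter_at_def)

lemma letter_at_eq_None_iff: "letter_at u i = None \<longleftrightarrow> length u \<le> i"
  by (simp add: letter_at_def)

lemma letter_at_eqI: "u = v" if "\<And>i. letter_at u i = letter_at v i"
proof (rule nth_equalityI)
  have "i < length u \<longleftrightarrow> i < length v" for i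
    using that[of i] by (auto simp: letter_at_def split: if_splits)
  then show *: "length u = length v"
    by (metis linorder_neqE_nat less_irrefl)
  show "u ! i = v ! i" if "i < length u" for i
    using \<open>letter_at u i = letter_at v i\<close> that * by (simp add: letter_at_def)
qed

lemma letter_at_map_filter_padded:
  assumes "padded r w"
  shows "letter_at (List.map_filter r w) i = Option.bind (letter_at w i) r"
  using assms
proof (induction w arbitrary: i)
  case Nil
  then show ?case by simp
next
  case (Cons a w)
  show ?case
  proof (cases "r a")
    case None
    then have *: "\<forall>b\<in>set w. r b = None"
      using Cons.prems by (simp add: padded_def)
    then have "List.map_filter r (a # w) = []"
      using None by (induction w) simp_all
    then show ?thesis
      using None * by (cases i) (auto simp: letter_at_def)
  next
    case (Some b)
    have "padded r w"
      using Cons.prems by (simp add: padded_def)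
    from Cons.IH[OF this] show ?thesis
      using Some by (cases i) simp_all
  qed
qed

lemma conv_alt: "conv u v = map (\<lambda>i. Pr (letter_at u i) (letter_at v i)) [0..<max (length u) (length v)]"
  by (simp add: conv_def letter_at_def)

lemma letter_at_conv:
  "letter_at (conv u v) i =
    (if i < max (length u) (length v) then Some (Pr (letter_at u i) (letter_at v i)) else None)"
  unfolding letter_at_def[of "conv u v"] by (simp add: conv_alt)

lemma conv_letter_lookup:
  "Option.bind (letter_at (conv u v) i) fst_track = letter_at u i"
  "Option.bind (letter_at (conv u v) i) snd_track = letter_at v i"
  using letter_at_eq_None_iff[of u i] letter_at_eq_None_iff[of v i] by (auto simp: letter_at_conv)

lemma padded_conv: "padded fst_track (conv u v)" "padded snd_track (conv u v)"
  by (auto simp: padded_def sorted_wrt_iff_nth_less conv_alt letter_at_eq_None_iff)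

lemma map_filter_conv [simp]:
  "List.map_filter fst_track (conv u v) = u"
  "List.map_filter snd_track (conv u v) = v"
  by (rule letter_at_eqI; simp add: letter_at_map_filter_padded padded_conv conv_letter_lookup)+

lemma conv_inject [simp]: "conv u v = conv u' v' \<longleftrightarrow> u = u' \<and> v = v'"
  by (metis map_filter_conv)

lemma Pr_None_None_notin_conv: "Pr None None \<notin> set (conv u v)"
proof
  assume "Pr None None \<in> set (conv u v)"
  then obtain i where "i < max (length u) (length v)" "letter_at u i = None" "letter_at v i = None"
    by (auto simp: conv_alt)
  then show False
    by (simp add: letter_at_eq_None_iff)
qed

text \<open>
  Each track has a letter exactly on an initial segment, and no position is padding on both, so the
  longer of the two tracks is as long as the word itself.
\<close>

lemma conv_of_tracks:
  assumes "padded fst_track w" "padded snd_track w" and "set w \<subseteq> range (case_prod Pr) - {Pr None None}"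
  shows "conv (List.map_filter fst_track w) (List.map_filter snd_track w) = w"
proof (rule letter_at_eqI)
  fix i
  let ?u = "List.map_filter fst_track w" and ?v = "List.map_filter snd_track w"
  have u: "letter_at ?u i = Option.bind (letter_at w i) fst_track"
    and v: "letter_at ?v i = Option.bind (letter_at w i) snd_track"
    using assms by (simp_all add: letter_at_map_filter_padded)
  show "letter_at (conv ?u ?v) i = letter_at w i"
  proof (cases "letter_at w i")
    case None
    then have "letter_at ?u i = None" "letter_at ?v i = None"
      using u v by simp_all
    then have "\<not> i < max (length ?u) (length ?v)"
      by (simp add: letter_at_eq_None_iff less_max_iff_disj)
    then show ?thesis
      using None by (simp add: letter_at_conv)
  next
    case (Some c)
    then have "c \<in> set w"
      by (auto simp: letter_at_def split: if_splits)
    then obtain a b where c: "c = Pr a b" "a \<noteq> None \<or> b \<noteq> None"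
      using assms(3) by fastforce
    then have "i < max (length ?u) (length ?v)"
      using u v Some letter_at_eq_None_iff[of ?u i] letter_at_eq_None_iff[of ?v i]
      by (auto simp: less_max_iff_disj)
    then show ?thesis
      using u v Some c by (simp add: letter_at_conv)
  qed
qed

definition conv_alphabet :: "'a letter set \<Rightarrow> 'a letter set \<Rightarrow> 'a letter set" where
  "conv_alphabet \<Delta> \<Sigma> =
     case_prod Pr ` (insert None (Some ` \<Delta>) \<times> insert None (Some ` \<Sigma>)) - {Pr None None}"

lemma finite_conv_alphabet: "finite \<Delta> \<Longrightarrow> finite \<Sigma> \<Longrightarrow> finite (conv_alphabet \<Delta> \<Sigma>)"
  by (simp add: conv_alphabet_def)

lemma conv_alphabet_subset: "conv_alphabet \<Delta> \<Sigma> \<subseteq> range (case_prod Pr) - {Pr None None}"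
  unfolding conv_alphabet_def by (intro Diff_mono image_mono) simp_all

lemma conv_in_lists:
  assumes "u \<in> lists \<Delta>" "v \<in> lists \<Sigma>"
  shows "conv u v \<in> lists (conv_alphabet \<Delta> \<Sigma>)"
proof -
  have at: "letter_at u i \<in> insert None (Some ` \<Delta>)" "letter_at v i \<in> insert None (Some ` \<Sigma>)" for i
    using assms by (auto simp: letter_at_def in_lists_conv_set)
  have "Pr (letter_at u i) (letter_at v i) \<in>
      case_prod Pr ` (insert None (Some ` \<Delta>) \<times> insert None (Some ` \<Sigma>))" for i
    using image_eqI[OF _ SigmaI[OF at(1)[of i] at(2)[of i]], where f = "case_prod Pr"] by simp
  then have "set (conv u v) \<subseteq> case_prod Pr ` (insert None (Some ` \<Delta>) \<times> insert None (Some ` \<Sigma>))"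
    unfolding conv_alt set_map by blast
  then show ?thesis
    using Pr_None_None_notin_conv[of u v] by (auto simp: conv_alphabet_def in_lists_conv_set)
qed

text \<open>
  The track \<open>r\<close> of each of the two components of a convolution, as a letter of a convolution. If both
  are padding, the letter is erased: the convolution of the tracks ends earlier than the word.
\<close>

definition track_pair :: "('a letter \<Rightarrow> 'a letter option) \<Rightarrow> 'a letter \<Rightarrow> 'a letter option" where
  "track_pair r c =
     (let a = Option.bind (fst_track c) r; b = Option.bind (snd_track c) r
      in if a = None \<and> b = None then None else Some (Pr a b))"

text \<open>
  Erasing commutes with convolution because it preserves positions in both padded words, and so
  keeps letters that were aligned in the convolution aligned.
\<close>

lemma map_filter_track_pair_conv:
  assumes "padded r u" "padded r v"
  shows "List.map_filter (track_pair r) (conv u v) =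
         conv (List.map_filter r u) (List.map_filter r v)"
proof (rule letter_at_eqI)
  fix i
  let ?N = "max (length u) (length v)"
  have at: "Option.bind (letter_at u i) r = letter_at (List.map_filter r u) i"
    "Option.bind (letter_at v i) r = letter_at (List.map_filter r v) i" for i
    using assms by (simp_all add: letter_at_map_filter_padded)
  have pair: "track_pair r (Pr (letter_at u i) (letter_at v i)) =
      letter_at (conv (List.map_filter r u) (List.map_filter r v)) i" for i
    by (auto simp: track_pair_def Let_def at letter_at_conv letter_at_eq_None_iff)
  have "padded (track_pair r) (conv u v)"
    unfolding padded_def sorted_wrt_iff_nth_less
    by (auto simp: conv_alt pair letter_at_eq_None_iff)
  then have "letter_at (List.map_filter (track_pair r) (conv u v)) i =
      Option.bind (letter_at (conv u v) i) (track_pair r)"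
    by (rule letter_at_map_filter_padded)
  also have "\<dots> = letter_at (conv (List.map_filter r u) (List.map_filter r v)) i"
  proof (cases "i < ?N")
    case True
    then show ?thesis by (simp add: letter_at_conv[of u v] pair)
  next
    case False
    then have "letter_at u i = None" "letter_at v i = None"
      by (simp_all add: letter_at_eq_None_iff)
    then show ?thesis
      using False pair[of i] by (simp add: letter_at_conv[of u v] track_pair_def)
  qed
  finally show "letter_at (List.map_filter (track_pair r) (conv u v)) i =
      letter_at (conv (List.map_filter r u) (List.map_filter r v)) i" .
qed

text \<open>
  Padded words keep the positions of their tracks, so equality of the tracks is a condition on each
  letter of the convolution separately.
\<close>

lemma tracks_agree_iff:
  assumes "padded s u" "padded s v"
  shows "List.map_filter s u = List.map_filter s v \<longleftrightarrow>
         (\<forall>c\<in>set (conv u v). Option.bind (fst_track c) s = Option.bind (snd_track c) s)"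
    (is "?L \<longleftrightarrow> ?R")
proof -
  have "?L \<longleftrightarrow> (\<forall>i. Option.bind (letter_at u i) s = Option.bind (letter_at v i) s)"
    using assms by (metis letter_at_eqI letter_at_map_filter_padded)
  also have "\<dots> \<longleftrightarrow> (\<forall>i < max (length u) (length v).
      Option.bind (letter_at u i) s = Option.bind (letter_at v i) s)"
    \<comment> \<open>Beyond both words, the two sides are \<open>None\<close>.\<close>
    using letter_at_eq_None_iff[of u] letter_at_eq_None_iff[of v]
    by (metis linorder_not_less max.bounded_iff)
  also have "\<dots> \<longleftrightarrow> ?R"
    by (auto simp: conv_alt)
  finally show ?thesis .
qed

section \<open>Padding is a regular condition\<close>

lemma regular_padded:
  assumes "finite \<Sigma>"
  shows "regular_language {w \<in> lists \<Sigma>. padded r w}"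
proof -
  \<comment> \<open>State 0: no padding read so far; state 1: padding has begun; state 2: a letter followed
    padding.\<close>
  define \<delta> :: "nat \<Rightarrow> _ \<Rightarrow> nat" where
    "\<delta> q a = (if q = 2 then 2 else if r a = None then 1 else if q = 0 then 0 else 2)" for q a
  have run: "foldl \<delta> 0 w =
      (if padded r w then if \<exists>a\<in>set w. r a = None then 1 else 0 else 2)" for w
    by (induction w rule: rev_induct) (auto simp: padded_def sorted_wrt_append \<delta>_def)
  have accept: "{w \<in> lists \<Sigma>. padded r w} = {w \<in> lists \<Sigma>. foldl \<delta> 0 w \<in> {0, 1}}"
    by (auto simp: run)
  have closed: "\<forall>q\<in>{0, 1, 2}. \<forall>a\<in>\<Sigma>. \<delta> q a \<in> {0, 1, 2}"
    by (auto simp: \<delta>_def)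
  show ?thesis
    unfolding regular_language_def
  proof (intro exI)
    show "finite \<Sigma> \<and> finite {0, 1, 2 :: nat} \<and> (0 :: nat) \<in> {0, 1, 2} \<and>
        {0, 1} \<subseteq> {0, 1, 2 :: nat} \<and> (\<forall>q\<in>{0, 1, 2}. \<forall>a\<in>\<Sigma>. \<delta> q a \<in> {0, 1, 2}) \<and>
        {w \<in> lists \<Sigma>. padded r w} = {w \<in> lists \<Sigma>. foldl \<delta> 0 w \<in> {0, 1}}"
      using assms accept closed by simp
  qed
qed

section \<open>Closure properties of the class\<close>

locale closed_language_class =
  fixes C :: "'a language set"
  assumes language_class: "language_class C"
    and inter_regular: "closed_inter_regular C"
    and finite_inter: "closed_finite_inter C"
    and inverse_hom: "closed_inverse_hom C"
begin

lemma finite_alphabet: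
  assumes "L \<in> C"
  obtains \<Sigma> where "finite \<Sigma>" "L \<subseteq> lists \<Sigma>"
  using assms language_class unfolding language_class_def by blast

lemma inter_in_class: "K \<inter> L \<in> C" if "K \<in> C" "L \<in> C"
proof -
  have "\<Inter>{K, L} \<in> C"
    using finite_inter[unfolded closed_finite_inter_def, rule_format, of "{K, L}"] that by simp
  then show ?thesis by simp
qed

lemma inter_padded_in_class:
  "K \<in> C \<Longrightarrow> finite \<Sigma> \<Longrightarrow> K \<inter> {w \<in> lists \<Sigma>. padded r w} \<in> C"
  by (rule inter_regular[unfolded closed_inter_regular_def, rule_format, OF _ regular_padded])

lemma inverse_map_filter_in_class:
  assumes "M \<in> C" "finite \<Delta>"
  shows "{w \<in> lists \<Delta>. List.map_filter f w \<in> M} \<in> C"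
proof -
  obtain \<Sigma> where \<Sigma>: "finite \<Sigma>" "M \<subseteq> lists \<Sigma>"
    using assms(1) by (rule finite_alphabet)
  \<comment> \<open>The target alphabet of the homomorphism also has to contain the images of letters that occur
    in no word of \<open>M\<close>.\<close>
  define \<Sigma>' where "\<Sigma>' = \<Sigma> \<union> (the \<circ> f) ` \<Delta>"
  have "finite \<Sigma>'" "M \<subseteq> lists \<Sigma>'"
    using \<Sigma> assms(2) by (auto simp: \<Sigma>'_def)
  moreover have "List.map_filter f w \<in> lists \<Sigma>'" if "w \<in> lists \<Delta>" for w
    using that by (force simp: map_filter_def \<Sigma>'_def)
  then have "word_hom \<Delta> \<Sigma>' (List.map_filter f)"
    by (simp add: word_hom_def map_filter_def)
  ultimately show ?thesis
    using inverse_hom[unfolded closed_inverse_hom_def, rule_format,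
        of \<Delta> \<Sigma>' "List.map_filter f" M] assms by simp
qed

text \<open>
  A word over \<open>conv_alphabet\<close> is a convolution as soon as both of its tracks are padded, since this
  alphabet has no letter that is padding on both tracks.
\<close>

lemma convolutions_in_class:
  assumes "K \<in> C" "L \<in> C"
  shows "{conv u v | u v. u \<in> K \<and> v \<in> L} \<in> C"
proof -
  obtain \<Delta> where \<Delta>: "finite \<Delta>" "K \<subseteq> lists \<Delta>"
    using assms(1) by (rule finite_alphabet)
  obtain \<Sigma> where \<Sigma>: "finite \<Sigma>" "L \<subseteq> lists \<Sigma>"
    using assms(2) by (rule finite_alphabet)
  let ?A = "conv_alphabet \<Delta> \<Sigma>"
  have fin: "finite ?A"
    using \<Delta> \<Sigma> by (simp add: finite_conv_alphabet)
  have "{conv u v | u v. u \<in> K \<and> v \<in> L} =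
      {w \<in> lists ?A. List.map_filter fst_track w \<in> K} \<inter>
      {w \<in> lists ?A. List.map_filter snd_track w \<in> L} \<inter>
      {w \<in> lists ?A. padded fst_track w} \<inter> {w \<in> lists ?A. padded snd_track w}"
    (is "?L = ?R")
  proof (intro equalityI subsetI)
    fix w assume "w \<in> ?L"
    then obtain u v where w: "w = conv u v" "u \<in> K" "v \<in> L" by blast
    then have "w \<in> lists ?A"
      using conv_in_lists[OF subsetD[OF \<Delta>(2)] subsetD[OF \<Sigma>(2)]] by simp
    then show "w \<in> ?R"
      using w by (simp add: padded_conv)
  next
    fix w assume w: "w \<in> ?R"
    then have "set w \<subseteq> ?A"
      by (simp add: in_lists_conv_set subset_iff)
    then have "set w \<subseteq> range (case_prod Pr) - {Pr None None}"
      using conv_alphabet_subset by (rule order_trans)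
    then have eq: "conv (List.map_filter fst_track w) (List.map_filter snd_track w) = w"
      using w conv_of_tracks[of w] by simp
    have "conv (List.map_filter fst_track w) (List.map_filter snd_track w) \<in> ?L"
      using w by simp
    then show "w \<in> ?L"
      unfolding eq .
  qed
  also have "\<dots> \<in> C"
    by (intro inter_padded_in_class[OF _ fin] inter_in_class inverse_map_filter_in_class[OF _ fin]
        assms)
  finally show ?thesis .
qed

text \<open>
  The shape of a multiplication language when the generator acts on the track \<open>r\<close> and fixes the
  track \<open>s\<close>. Among convolutions of words in \<open>K\<close>, the condition on \<open>r\<close> is the inverse image of \<open>M\<close> under one homomorphism, and the condition on \<open>s\<close> only
  restricts the letters that may occur.
\<close>

lemma track_multiplication_in_class:
  assumes "K \<in> C" "M \<in> C"
    and padded: "\<And>u. u \<in> K \<Longrightarrow> padded r u" "\<And>u. u \<in> K \<Longrightarrow> padded s u"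
  shows "{conv u v | u v. u \<in> K \<and> v \<in> K \<and>
            conv (List.map_filter r u) (List.map_filter r v) \<in> M \<and>
            List.map_filter s u = List.map_filter s v} \<in> C"
proof -
  obtain \<Delta> where \<Delta>: "finite \<Delta>" "K \<subseteq> lists \<Delta>"
    using assms(1) by (rule finite_alphabet)
  define A where "A = {c \<in> conv_alphabet \<Delta> \<Delta>.
    Option.bind (fst_track c) s = Option.bind (snd_track c) s}"
  have "finite A"
    using \<Delta> by (simp add: A_def finite_conv_alphabet)
  define W where "W = {w \<in> lists A. List.map_filter (track_pair r) w \<in> M}"
  have condition: "conv u v \<in> W \<longleftrightarrow>
      conv (List.map_filter r u) (List.map_filter r v) \<in> M \<and>
      List.map_filter s u = List.map_filter s v" if "u \<in> K" "v \<in> K" for u v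
  proof -
    have "conv u v \<in> lists (conv_alphabet \<Delta> \<Delta>)"
      using that conv_in_lists[OF subsetD[OF \<Delta>(2)] subsetD[OF \<Delta>(2)]] by simp
    then have "conv u v \<in> lists A \<longleftrightarrow> List.map_filter s u = List.map_filter s v"
      using that padded by (auto simp: tracks_agree_iff A_def in_lists_conv_set)
    then show ?thesis
      using map_filter_track_pair_conv[OF padded(1)[OF that(1)] padded(1)[OF that(2)]]
      by (auto simp: W_def)
  qed
  have "{conv u v | u v. u \<in> K \<and> v \<in> K \<and>
            conv (List.map_filter r u) (List.map_filter r v) \<in> M \<and>
            List.map_filter s u = List.map_filter s v} =
      {conv u v | u v. u \<in> K \<and> v \<in> K} \<inter> W"
    by (auto simp: condition)
  also have "\<dots> \<in> C"
    unfolding W_def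
    by (rule inter_in_class convolutions_in_class inverse_map_filter_in_class assms(1,2) \<open>finite A\<close>)+
  finally show ?thesis .
qed

end

section \<open>Generators of a direct product\<close>

lemma symmetric_generating_set_DirProd:
  assumes "group G" "group H"
    and X: "symmetric_generating_set G X" and Y: "symmetric_generating_set H Y"
  shows "symmetric_generating_set (G \<times>\<times> H) (X \<times> {\<one>\<^bsub>H\<^esub>} \<union> {\<one>\<^bsub>G\<^esub>} \<times> Y)"
proof -
  interpret G: group G by fact
  interpret H: group H by fact
  interpret GH: group "G \<times>\<times> H"
    using assms(1,2) by (rule DirProd_group)
  let ?Z = "X \<times> {\<one>\<^bsub>H\<^esub>} \<union> {\<one>\<^bsub>G\<^esub>} \<times> Y"
  have sub: "X \<subseteq> carrier G" "Y \<subseteq> carrier H"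
    and gen: "generate G X = carrier G" "generate H Y = carrier H"
    and inv: "\<And>x. x \<in> X \<Longrightarrow> inv\<^bsub>G\<^esub> x \<in> X" "\<And>y. y \<in> Y \<Longrightarrow> inv\<^bsub>H\<^esub> y \<in> Y"
    using X Y by (simp_all add: symmetric_generating_set_def)
  have Z: "?Z \<subseteq> carrier (G \<times>\<times> H)"
    using sub by auto
  have Z_inv: "inv\<^bsub>G \<times>\<times> H\<^esub> z \<in> ?Z" if "z \<in> ?Z" for z
    using that sub inv assms(1,2) by (auto simp: inv_DirProd subset_iff)
  have left: "(g, \<one>\<^bsub>H\<^esub>) \<in> generate (G \<times>\<times> H) ?Z" if "g \<in> generate G X" for g
    using that
  proof induction
    case one
    then show ?case using generate.one[of "G \<times>\<times> H" ?Z] by simp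
  next
    case (incl x)
    then show ?case by (simp add: generate.incl)
  next
    case (inv x)
    then show ?case using \<open>\<And>x. x \<in> X \<Longrightarrow> inv\<^bsub>G\<^esub> x \<in> X\<close> by (simp add: generate.incl)
  next
    case (eng g g')
    then show ?case using generate.eng[OF eng.IH] by simp
  qed
  have right: "(\<one>\<^bsub>G\<^esub>, h) \<in> generate (G \<times>\<times> H) ?Z" if "h \<in> generate H Y" for h
    using that
  proof induction
    case one
    then show ?case using generate.one[of "G \<times>\<times> H" ?Z] by simp
  next
    case (incl x)
    then show ?case by (simp add: generate.incl)
  next
    case (inv x)
    then show ?case using \<open>\<And>y. y \<in> Y \<Longrightarrow> inv\<^bsub>H\<^esub> y \<in> Y\<close> by (simp add: generate.incl)
  next
    case (eng h h')
    then show ?case using generate.eng[OF eng.IH] by simp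
  qed
  have "carrier (G \<times>\<times> H) \<subseteq> generate (G \<times>\<times> H) ?Z"
  proof
    fix z assume "z \<in> carrier (G \<times>\<times> H)"
    then obtain g h where z: "z = (g, h)" "g \<in> carrier G" "h \<in> carrier H" by auto
    then have "(g, \<one>\<^bsub>H\<^esub>) \<otimes>\<^bsub>G \<times>\<times> H\<^esub> (\<one>\<^bsub>G\<^esub>, h) \<in> generate (G \<times>\<times> H) ?Z"
      using left right gen by (intro generate.eng) auto
    then show "z \<in> generate (G \<times>\<times> H) ?Z"
      using z by simp
  qed
  then show ?thesis
    using Z Z_inv GH.generate_incl[OF Z] unfolding symmetric_generating_set_def by blast
qed

section \<open>The direct product is graph automatic\<close>

theorem lemma5p2:
  fixes G :: "('g, 'm) monoid_scheme" and H :: "('h, 'n) monoid_scheme"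
    and X :: "'g set" and Y :: "'h set"
    and \<Lambda> \<Gamma> :: "'a letter set" and C :: "'a language set"
  assumes "group G" and "group H"
    and "symmetric_generating_set G X" and "symmetric_generating_set H Y"
    and "finite \<Lambda>" and "finite \<Gamma>"
    and "language_class C"
    and "closed_inter_regular C" and "closed_finite_inter C" and "closed_inverse_hom C"
    and "graph_automatic C G X \<Lambda>" and "graph_automatic C H Y \<Gamma>"
  shows "graph_automatic_group C (G \<times>\<times> H)"
proof -
  interpret G: group G by fact
  interpret H: group H by fact
  interpret closed_language_class C
    using assms(7-10) by unfold_locales
  obtain LG barG where G: "normal_form G \<Lambda> LG barG" "LG \<in> C"
    "\<And>x. x \<in> X \<Longrightarrow> mult_language G LG barG x \<in> C"
    using assms(11) unfolding graph_automatic_def by blast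
  obtain LH barH where H: "normal_form H \<Gamma> LH barH" "LH \<in> C"
    "\<And>y. y \<in> Y \<Longrightarrow> mult_language H LH barH y \<in> C"
    using assms(12) unfolding graph_automatic_def by blast
  note bij = G(1)[unfolded normal_form_def, THEN conjunct2] H(1)[unfolded normal_form_def, THEN conjunct2]
  have carrier: "u \<in> LG \<Longrightarrow> barG u \<in> carrier G" "v \<in> LH \<Longrightarrow> barH v \<in> carrier H" for u v
    using bij by (auto dest: bij_betwE)
  have inj: "u \<in> LG \<Longrightarrow> u' \<in> LG \<Longrightarrow> barG u = barG u' \<longleftrightarrow> u = u'"
    "v \<in> LH \<Longrightarrow> v' \<in> LH \<Longrightarrow> barH v = barH v' \<longleftrightarrow> v = v'" for u u' v v'
    using bij by (auto simp: bij_betw_def inj_on_eq_iff)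

  define L where "L = {conv u v | u v. u \<in> LG \<and> v \<in> LH}"
  define bar where
    "bar w = (barG (List.map_filter fst_track w), barH (List.map_filter snd_track w))" for w
  have "L \<in> C"
    unfolding L_def using G(2) H(2) by (rule convolutions_in_class)
  have L_padded: "padded fst_track w" "padded snd_track w" if "w \<in> L" for w
    using that by (auto simp: L_def padded_conv)

  have nf: "normal_form (G \<times>\<times> H) (conv_alphabet \<Lambda> \<Gamma>) L bar"
    unfolding normal_form_def
  proof
    have "u \<in> lists \<Lambda>" if "u \<in> LG" for u
      using that G(1) unfolding normal_form_def by (meson subsetD)
    moreover have "v \<in> lists \<Gamma>" if "v \<in> LH" for v
      using that H(1) unfolding normal_form_def by (meson subsetD)
    ultimately have "conv u v \<in> lists (conv_alphabet \<Lambda> \<Gamma>)" if "u \<in> LG" "v \<in> LH" for u v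
      using that by (intro conv_in_lists)
    then show "L \<subseteq> lists (conv_alphabet \<Lambda> \<Gamma>)"
      unfolding L_def by blast
    have "inj_on bar L"
      by (auto simp: inj_on_def L_def bar_def inj)
    moreover have "bar ` L = barG ` LG \<times> barH ` LH"
      unfolding L_def bar_def by (force simp: image_iff)
    ultimately show "bij_betw bar L (carrier (G \<times>\<times> H))"
      using bij by (simp add: bij_betw_def)
  qed

  have multG: "mult_language (G \<times>\<times> H) L bar (x, \<one>\<^bsub>H\<^esub>) \<in> C" if "x \<in> X" for x
  proof -
    have "mult_language (G \<times>\<times> H) L bar (x, \<one>\<^bsub>H\<^esub>) =
        {conv u v | u v. u \<in> L \<and> v \<in> L \<and>
          conv (List.map_filter fst_track u) (List.map_filter fst_track v)
            \<in> mult_language G LG barG x \<and>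
          List.map_filter snd_track u = List.map_filter snd_track v}"
      unfolding mult_language_def
      by (intro Collect_cong ex_cong1 conj_cong refl) (auto simp: L_def bar_def carrier inj)
    then show ?thesis
      using track_multiplication_in_class[OF \<open>L \<in> C\<close> G(3)[OF that] L_padded] by simp
  qed
  have multH: "mult_language (G \<times>\<times> H) L bar (\<one>\<^bsub>G\<^esub>, y) \<in> C" if "y \<in> Y" for y
  proof -
    have "mult_language (G \<times>\<times> H) L bar (\<one>\<^bsub>G\<^esub>, y) =
        {conv u v | u v. u \<in> L \<and> v \<in> L \<and>
          conv (List.map_filter snd_track u) (List.map_filter snd_track v)
            \<in> mult_language H LH barH y \<and>
          List.map_filter fst_track u = List.map_filter fst_track v}"
      unfolding mult_language_def
      by (intro Collect_cong ex_cong1 conj_cong refl) (auto simp: L_def bar_def carrier inj)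
    then show ?thesis
      using track_multiplication_in_class[OF \<open>L \<in> C\<close> H(3)[OF that] L_padded(2,1)] by simp
  qed

  have "graph_automatic C (G \<times>\<times> H) (X \<times> {\<one>\<^bsub>H\<^esub>} \<union> {\<one>\<^bsub>G\<^esub>} \<times> Y) (conv_alphabet \<Lambda> \<Gamma>)"
    unfolding graph_automatic_def using nf \<open>L \<in> C\<close> multG multH by blast
  then show ?thesis
    unfolding graph_automatic_group_def
    using symmetric_generating_set_DirProd[OF assms(1-4)] finite_conv_alphabet[OF assms(5,6)]
    by blast
qed

end
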